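(* Assume that $X$ is a topological tree with a group structure $(\cdot,{}^{-1},e)$ such that for every $g\in X$ the left translation $x\mapsto g\cdot x$ and the right translation $x\mapsto x\cdot g$ are continuous. If $X$ contains more than one point, then $X$ is homeomorphic to $\mathbb{R}$.
   Context: An arc in a topological space is a subset homeomorphic to $[0,1]$. A space is arcwise connected if any two different points $x,y$ are the end points of an arc in it. A topological tree is a metrizable topological space $X$ such that: (1) $X$ is uniquely arcwise connected, i.e. for any two different points $x,y\in X$ there is a unique arc in $X$ with end points $x$ and $y$; (2) $X$ is locally arcwise connected, i.e. for any $x\in X$ and any neighbourhood $U$ of $x$ there is an arcwise connected open neighbourhood $V$ of $x$ contained in $U$. *)

theory Defs
  imports "HOL-Analysis.Analysis" "HOL-Algebra.Group"
begin

definition arc_with_ends :: "'a topology \<Rightarrow> 'a \<Rightarrow> 'a \<Rightarrow> 'a set \<Rightarrow> bool" where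
  "arc_with_ends X x y A \<longleftrightarrow>
     A \<subseteq> topspace X \<and>
     (\<exists>h. homeomorphic_map (top_of_set {0..1::real}) (subtopology X A) h \<and> h 0 = x \<and> h 1 = y)"

definition arcwise_connected_space :: "'a topology \<Rightarrow> bool" where
  "arcwise_connected_space X \<longleftrightarrow>
     (\<forall>x\<in>topspace X. \<forall>y\<in>topspace X. x \<noteq> y \<longrightarrow> (\<exists>A. arc_with_ends X x y A))"

definition uniquely_arcwise_connected_space :: "'a topology \<Rightarrow> bool" where
  "uniquely_arcwise_connected_space X \<longleftrightarrow>
     (\<forall>x\<in>topspace X. \<forall>y\<in>topspace X. x \<noteq> y \<longrightarrow> (\<exists>!A. arc_with_ends X x y A))"

text \<open>A neighbourhood \<open>U\<close> of \<open>x\<close> need not be open; \<open>W\<close> is an open set witnessing that \<open>U\<close> is one.\<close>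
definition locally_arcwise_connected_space :: "'a topology \<Rightarrow> bool" where
  "locally_arcwise_connected_space X \<longleftrightarrow>
     (\<forall>x\<in>topspace X. \<forall>U\<subseteq>topspace X. (\<exists>W. openin X W \<and> x \<in> W \<and> W \<subseteq> U) \<longrightarrow>
        (\<exists>V. openin X V \<and> x \<in> V \<and> V \<subseteq> U \<and> arcwise_connected_space (subtopology X V)))"

definition topological_tree :: "'a topology \<Rightarrow> bool" where
  "topological_tree X \<longleftrightarrow>
     metrizable_space X \<and> uniquely_arcwise_connected_space X \<and> locally_arcwise_connected_space X"

end

theory Submission
  imports Defs
begin

text \<open>
  Write \<open>[x, y]\<close> for the arc from \<open>x\<close> to \<open>y\<close>, called \<open>seg x y\<close> below. Arcs satisfy the usual
  axioms of betweenness in a tree: three points have a median, and two arcs that meet only in a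
  common end form an arc together. Continuous injections of the tree into itself preserve arcs.

  The key is that right translations commute with left translations. By the intermediate value
  theorem, an injective continuous self-map \<open>f\<close> without fixed points has an axis: there is a \<open>z\<close>
  with \<open>f z \<in> [z, f (f z)]\<close> (lemma \<open>fixed_point_free_axis\<close>). Apply this to \<open>x \<mapsto> x a\<close> with
  \<open>a \<noteq> e\<close>. Left translations preserve arcs, commute with this map and act transitively, so
  every point lies on its axis: \<open>x a \<in> [x, x a a]\<close> for all \<open>x\<close>. Writing \<open>a x\<close> as \<open>x\<close> times the
  conjugate of \<open>a\<close> by \<open>x\<close> gives the same for left translations.

  Consequently the tree does not branch. If an arc \<open>[e, b]\<close> left the axis of \<open>x \<mapsto> a x\<close> at \<open>e\<close>, then
  the arc from \<open>b\<close> to \<open>a b\<close> would run to the axis, along it and off again at \<open>a\<close>; it would arrive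
  at \<open>a b\<close> along the same piece on which \<open>[a b, a a b]\<close> starts, so \<open>b\<close> would not be on an axis of
  the translation by \<open>a\<close>. Hence \<open>[e, b]\<close> starts towards \<open>a\<close> or towards the inverse of \<open>a\<close>
  (\<open>two_directions\<close>), and of any three points one lies between the other two (\<open>no_branching\<close>).

  Fix \<open>a \<noteq> e\<close>. The integer powers of \<open>a\<close> occur in order along arcs. They cannot all stay inside
  one arc \<open>[e, y]\<close>, since they would converge there to a fixed point of the right translation
  by \<open>a\<close> (\<open>powers_leave_arc\<close>); as there is no branching, the arcs between opposite powers
  exhaust the tree (\<open>powers_cofinal\<close>). Gluing the translates of a parametrisation of \<open>[e, a]\<close>
  gives a continuous bijection from the real line. Its inverse is continuous because of
  local arcwise connectedness (\<open>homeomorphic_real_if_bijective_line\<close>).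
\<close>

section \<open>Arcs in a topological tree\<close>

locale tree_space =
  fixes X :: "'a topology"
  assumes tree: "topological_tree X"
begin

text \<open>
  The trivial case \<open>x = y\<close>, in which there is no arc, is included so that the rules for
  betweenness need no distinction of cases.
\<close>

definition seg :: "'a \<Rightarrow> 'a \<Rightarrow> 'a set" where
  "seg x y = (if x = y then {x} else (THE A. arc_with_ends X x y A))"

lemma hausdorff: "Hausdorff_space X"
  using tree metrizable_imp_Hausdorff_space unfolding topological_tree_def by blast

lemma arc_unique:
  assumes "x \<in> topspace X" "y \<in> topspace X" "x \<noteq> y"
  shows "\<exists>!A. arc_with_ends X x y A"
  using tree assms unfolding topological_tree_def uniquely_arcwise_connected_space_def by blast

lemma arcwise_connected_nbhd:
  assumes "openin X W" "x \<in> W"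
  obtains V where "openin X V" "x \<in> V" "V \<subseteq> W" "arcwise_connected_space (subtopology X V)"
proof -
  have W: "W \<subseteq> topspace X" "x \<in> topspace X" using assms openin_subset by blast+
  have ex: "\<exists>W'. openin X W' \<and> x \<in> W' \<and> W' \<subseteq> W" using assms by blast
  have "locally_arcwise_connected_space X"
    using tree unfolding topological_tree_def by blast
  from this[unfolded locally_arcwise_connected_space_def, rule_format, OF W(2,1) ex]
  show thesis using that by blast
qed

lemma seg_eqI:
  assumes "arc_with_ends X x y A" "x \<noteq> y"
  shows "seg x y = A"
proof -
  obtain h where h: "homeomorphic_map (top_of_set {0..1::real}) (subtopology X A) h"
    "h 0 = x" "h 1 = y" and A: "A \<subseteq> topspace X"
    using assms unfolding arc_with_ends_def by blast
  have "h ` {0..1} = A"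
    using homeomorphic_imp_surjective_map[OF h(1)] A by auto
  then have "x \<in> topspace X" "y \<in> topspace X"
    using A h(2,3) by (auto simp: image_subset_iff)
  then show ?thesis
    using arc_unique assms the1_equality unfolding seg_def by metis
qed

lemma embedding_interval:
  assumes "continuous_map (top_of_set {a..b::real}) X h" "inj_on h {a..b}"
  shows "homeomorphic_map (top_of_set {a..b}) (subtopology X (h ` {a..b})) h"
proof (rule continuous_imp_homeomorphic_map)
  show "compact_space (top_of_set {a..b})"
    by (simp add: compact_space_subtopology)
  show "Hausdorff_space (subtopology X (h ` {a..b}))"
    by (simp add: Hausdorff_space_subtopology hausdorff)
  show "continuous_map (top_of_set {a..b}) (subtopology X (h ` {a..b})) h"
    using assms by (simp add: continuous_map_in_subtopology)
  show "h ` topspace (top_of_set {a..b}) = topspace (subtopology X (h ` {a..b}))"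
    using continuous_map_image_subset_topspace[OF assms(1)] by auto
  show "inj_on h (topspace (top_of_set {a..b}))"
    using assms by simp
qed

text \<open>
  Uniqueness of arcs makes every injective path run along the arcs between its points.
\<close>

lemma seg_image:
  assumes h: "continuous_map (top_of_set {a..b::real}) X h" "inj_on h {a..b}"
    and st: "s \<in> {a..b}" "t \<in> {a..b}"
  shows "seg (h s) (h t) = h ` closed_segment s t"
proof (cases "s = t")
  case True
  then show ?thesis by (simp add: seg_def)
next
  case False
  let ?l = "\<lambda>u. (1 - u) * s + u * t"
  have im: "?l ` {0..1} = closed_segment s t"
    by (auto simp: closed_segment_def)
  have sub: "closed_segment s t \<subseteq> {a..b}"
    using st by (auto simp: closed_segment_eq_real_ivl)
  have inj: "inj_on ?l {0..1}"
  proof (rule inj_onI)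
    fix u v assume "?l u = ?l v"
    then have "(u - v) * (t - s) = 0" by (simp add: algebra_simps)
    then show "u = v" using False by simp
  qed
  have c: "continuous_map (top_of_set {0..1}) (top_of_set {a..b}) ?l"
    using im sub by (auto simp: continuous_map_in_subtopology intro!: continuous_intros)
  have c2: "continuous_map (top_of_set {0..1}) X (h \<circ> ?l)"
    using c h(1) by (rule continuous_map_compose)
  have i2: "inj_on (h \<circ> ?l) {0..1}"
    using inj h(2) im sub by (metis comp_inj_on inj_on_subset)
  have im2: "(h \<circ> ?l) ` {0..1} = h ` closed_segment s t"
    by (metis im image_comp)
  have "arc_with_ends X (h s) (h t) (h ` closed_segment s t)"
    unfolding arc_with_ends_def
  proof (intro conjI exI)
    show "h ` closed_segment s t \<subseteq> topspace X"
      using continuous_map_image_subset_topspace[OF h(1)] sub by auto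
    show "homeomorphic_map (top_of_set {0..1}) (subtopology X (h ` closed_segment s t)) (h \<circ> ?l)"
      using embedding_interval[OF c2 i2] im2 by simp
  qed auto
  moreover have "h s \<noteq> h t"
    using False h(2) st by (auto dest: inj_onD)
  ultimately show ?thesis by (rule seg_eqI)
qed

lemma seg_param:
  assumes "x \<in> topspace X" "y \<in> topspace X" "x \<noteq> y"
  obtains h where "continuous_map (top_of_set {0..1::real}) X h" "inj_on h {0..1}"
    "h 0 = x" "h 1 = y" "seg x y = h ` {0..1}"
proof -
  obtain A where A: "arc_with_ends X x y A" using arc_unique assms by blast
  then obtain h where h: "homeomorphic_map (top_of_set {0..1::real}) (subtopology X A) h"
    "h 0 = x" "h 1 = y" and AX: "A \<subseteq> topspace X"
    unfolding arc_with_ends_def by blast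
  have "continuous_map (top_of_set {0..1}) X h"
    using homeomorphic_imp_continuous_map[OF h(1)] continuous_map_into_fulltopology by blast
  moreover have "inj_on h {0..1}"
    using homeomorphic_imp_injective_map[OF h(1)] by simp
  moreover have "seg x y = h ` {0..1}"
    using homeomorphic_imp_surjective_map[OF h(1)] seg_eqI[OF A assms(3)] AX by auto
  ultimately show thesis using that h by blast
qed

lemma seg_refl [simp]: "seg x x = {x}"
  by (simp add: seg_def)

lemma seg_subset:
  assumes "x \<in> topspace X" "y \<in> topspace X"
  shows "seg x y \<subseteq> topspace X"
proof (cases "x = y")
  case False
  then obtain h where "continuous_map (top_of_set {0..1::real}) X h" "seg x y = h ` {0..1}"
    using seg_param[OF assms] by metis
  then show ?thesis using continuous_map_image_subset_topspace by fastforce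
qed (use assms in auto)

lemma seg_in: "x \<in> topspace X \<Longrightarrow> y \<in> topspace X \<Longrightarrow> z \<in> seg x y \<Longrightarrow> z \<in> topspace X"
  using seg_subset by blast

lemma seg_ends:
  assumes "x \<in> topspace X" "y \<in> topspace X"
  shows "x \<in> seg x y" "y \<in> seg x y"
proof -
  have "x \<in> seg x y \<and> y \<in> seg x y"
  proof (cases "x = y")
    case False
    show ?thesis by (rule seg_param[OF assms False]) force
  qed auto
  then show "x \<in> seg x y" "y \<in> seg x y" by auto
qed

lemma seg_sym:
  assumes "x \<in> topspace X" "y \<in> topspace X"
  shows "seg x y = seg y x"
proof (cases "x = y")
  case False
  then obtain h where h: "continuous_map (top_of_set {0..1::real}) X h" "inj_on h {0..1}"
    "h 0 = x" "h 1 = y"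
    using seg_param[OF assms] by metis
  show ?thesis
    using seg_image[OF h(1,2), of 0 1] seg_image[OF h(1,2), of 1 0] h(3,4)
    by (simp add: closed_segment_commute)
qed auto

lemma closedin_seg:
  assumes "x \<in> topspace X" "y \<in> topspace X"
  shows "closedin X (seg x y)"
proof (cases "x = y")
  case True
  then show ?thesis
    using assms hausdorff by (simp add: closedin_Hausdorff_singleton)
next
  case False
  obtain h where h: "continuous_map (top_of_set {0..1::real}) X h" "seg x y = h ` {0..1}"
    using seg_param[OF assms False] by metis
  have "compactin X (h ` {0..1})"
    by (rule image_compactin[OF _ h(1)]) (simp add: compactin_subtopology)
  then show ?thesis
    using compactin_imp_closedin hausdorff h(2) by metis
qed

lemma seg_split:
  assumes "x \<in> topspace X" "z \<in> topspace X" "y \<in> seg x z"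
  shows "seg x z = seg x y \<union> seg y z" "seg x y \<inter> seg y z = {y}"
proof -
  have "seg x z = seg x y \<union> seg y z \<and> seg x y \<inter> seg y z = {y}"
  proof (cases "x = z")
    case False
    then obtain h where h: "continuous_map (top_of_set {0..1::real}) X h" "inj_on h {0..1}"
      "h 0 = x" "h 1 = z" "seg x z = h ` {0..1}"
      using seg_param[OF assms(1,2)] by metis
    obtain s where s: "s \<in> {0..1}" "y = h s" using assms(3) h(5) by auto
    have 1: "seg x y = h ` {0..s}" "seg y z = h ` {s..1}"
      using seg_image[OF h(1,2), of 0 s] seg_image[OF h(1,2), of s 1] h(3,4) s
      by (auto simp: closed_segment_eq_real_ivl)
    have "h ` {0..s} \<inter> h ` {s..1} = h ` ({0..s} \<inter> {s..1})"
      using s by (intro inj_on_image_Int[OF h(2), symmetric]) auto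
    moreover have "{0..s} \<inter> {s..1} = {s}" "{0..s} \<union> {s..1} = {0..1}" using s by auto
    ultimately show ?thesis
      using 1 h(5) s(2) by (metis image_Un image_empty image_insert)
  qed (use assms in auto)
  then show "seg x z = seg x y \<union> seg y z" "seg x y \<inter> seg y z = {y}" by auto
qed

text \<open>
  Two arcs that meet only in the common end can be traversed one after the other without
  repetition, so the concatenation is the unique arc between the outer ends.
\<close>

lemma seg_concat:
  assumes X: "x \<in> topspace X" "y \<in> topspace X" "z \<in> topspace X"
    and int: "seg x y \<inter> seg y z \<subseteq> {y}"
  shows "y \<in> seg x z"
proof (cases "x = y \<or> y = z")
  case True
  then show ?thesis using seg_ends X by auto
next
  case False
  obtain h where h: "continuous_map (top_of_set {0..1::real}) X h" "inj_on h {0..1}"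
    "h 0 = x" "h 1 = y" "seg x y = h ` {0..1}"
    using seg_param[OF X(1,2)] False by metis
  obtain k where k: "continuous_map (top_of_set {0..1::real}) X k" "inj_on k {0..1}"
    "k 0 = y" "k 1 = z" "seg y z = k ` {0..1}"
    using seg_param[OF X(2,3)] False by metis
  let ?f = "\<lambda>t. if t \<le> 1 then h t else (k \<circ> (\<lambda>t. t - 1)) t"
  have "continuous_map (top_of_set {0..2}) X ?f"
  proof (rule continuous_map_cases_le)
    have "{x. x \<in> topspace (top_of_set {0..2::real}) \<and> x \<le> 1} = {0..1}" by auto
    then show "continuous_map (subtopology (top_of_set {0..2}) {x. x \<in> topspace (top_of_set {0..2::real}) \<and> x \<le> 1}) X h"
      using h(1) by (simp add: subtopology_subtopology)
    have 1: "{x. x \<in> topspace (top_of_set {0..2::real}) \<and> 1 \<le> x} = {1..2}" by auto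
    have "continuous_map (top_of_set {1..2}) X (k \<circ> (\<lambda>t. t - 1))"
      by (rule continuous_map_compose[OF _ k(1)])
        (auto simp: continuous_map_in_subtopology intro!: continuous_intros)
    then show "continuous_map (subtopology (top_of_set {0..2}) {x. x \<in> topspace (top_of_set {0..2::real}) \<and> 1 \<le> x}) X (k \<circ> (\<lambda>t. t - 1))"
      unfolding 1 by (simp add: subtopology_subtopology)
  qed (use h k in auto)
  moreover have "inj_on ?f {0..2}"
  proof -
    \<comment> \<open>A value shared by the two halves lies on both arcs, so it is the common end \<open>y\<close>.\<close>
    have cross: False if "h s = k (t - 1)" "s \<in> {0..1}" "t \<in> {1<..2}" for s t
    proof -
      have "k (t - 1) \<in> seg y z" unfolding k(5) by (rule imageI) (use that in auto)
      moreover have "k (t - 1) \<in> seg x y"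
        unfolding h(5) that(1)[symmetric] by (rule imageI) (use that in auto)
      ultimately have "k (t - 1) = k 0" using int k(3) by auto
      then show False using inj_onD[OF k(2), of "t - 1" 0] that by auto
    qed
    show ?thesis
    proof (rule inj_onI)
      fix s t :: real
      assume st: "s \<in> {0..2}" "t \<in> {0..2}" "?f s = ?f t"
      consider "s \<le> 1" "t \<le> 1" | "s \<le> 1" "t > 1" | "s > 1" "t \<le> 1" | "s > 1" "t > 1" by linarith
      then show "s = t"
      proof cases
        case 1 then show ?thesis using st inj_onD[OF h(2), of s t] by auto
      next
        case 2 then show ?thesis using st cross[of s t] by auto
      next
        case 3 then show ?thesis using st cross[of t s] by auto
      next
        case 4 then show ?thesis using st inj_onD[OF k(2), of "s - 1" "t - 1"] by auto
      qed
    qed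
  qed
  ultimately have "seg (?f 0) (?f 2) = ?f ` closed_segment 0 2"
    by (rule seg_image) auto
  moreover have "?f 0 = x" "?f 2 = z" and f1: "?f 1 = y" using h k by auto
  moreover have one: "(1::real) \<in> closed_segment 0 2" by (auto simp: closed_segment_eq_real_ivl)
  ultimately have "seg x z = ?f ` closed_segment 0 2" by (simp only:)
  then show ?thesis
    using imageI[OF one, of ?f] f1 by (simp only:)
qed

lemma seg_subseg:
  assumes "x \<in> topspace X" "z \<in> topspace X" "y \<in> seg x z"
  shows "seg x y \<subseteq> seg x z" "seg y z \<subseteq> seg x z"
  using seg_split(1)[OF assms] by auto

text \<open>
  The first point \<open>m\<close> of the closed set \<open>seg x y\<close> on the way from \<open>z\<close> to \<open>y\<close> works: the arc from \<open>z\<close>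
  to \<open>m\<close> meets \<open>seg x y\<close> only in \<open>m\<close>, and so continues inside \<open>seg x y\<close> to \<open>x\<close>.
\<close>

lemma median_exists:
  assumes X: "x \<in> topspace X" "y \<in> topspace X" "z \<in> topspace X"
  obtains m where "m \<in> seg x y" "m \<in> seg y z" "m \<in> seg x z"
proof (cases "z = y")
  case True
  then show ?thesis using that seg_ends X by auto
next
  case False
  obtain h where h: "continuous_map (top_of_set {0..1::real}) X h" "inj_on h {0..1}"
    "h 0 = z" "h 1 = y" "seg z y = h ` {0..1}"
    using seg_param[OF X(3,2) False] by metis
  define T where "T = {t \<in> {0..1}. h t \<in> seg x y}"
  have "closedin (top_of_set {0..1}) T"
    using closedin_continuous_map_preimage[OF h(1) closedin_seg[OF X(1,2)]] by (simp add: T_def)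
  then have "closed T" using closedin_closed_trans closed_atLeastAtMost by blast
  moreover have "T \<noteq> {}"
    using h(4) seg_ends X by (auto simp: T_def intro!: exI[of _ 1])
  moreover have bdd: "bdd_below T" by (auto simp: T_def bdd_below_def)
  ultimately have t: "Inf T \<in> T" using closed_contains_Inf by blast
  define t where "t = Inf T"
  have t01: "t \<in> {0..1}" "h t \<in> seg x y" using t by (auto simp: T_def t_def)
  have zt: "seg z (h t) = h ` {0..t}"
    using seg_image[OF h(1,2), of 0 t] h(3) t01 by (auto simp: closed_segment_eq_real_ivl)
  have "seg z (h t) \<inter> seg x y \<subseteq> {h t}"
  proof
    fix v assume v: "v \<in> seg z (h t) \<inter> seg x y"
    then obtain s where s: "s \<in> {0..t}" "v = h s" using zt by auto
    then have "s \<in> T" using v t01 by (auto simp: T_def)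
    then have "t \<le> s" unfolding t_def using bdd by (rule cInf_lower)
    then show "v \<in> {h t}" using s by auto
  qed
  moreover have "seg (h t) x \<subseteq> seg x y"
    using seg_subseg[OF X(1,2) t01(2)] seg_sym X(1,2) seg_in t01(2) by metis
  ultimately have "h t \<in> seg z x"
    using X t01 seg_in by (intro seg_concat) blast+
  moreover have "h t \<in> seg z y" using h(5) t01 by auto
  ultimately show ?thesis using that[of "h t"] t01 seg_sym X by metis
qed

lemma seg_triangle:
  assumes X: "x \<in> topspace X" "y \<in> topspace X" "z \<in> topspace X"
  shows "seg x z \<subseteq> seg x y \<union> seg y z"
proof -
  obtain m where m: "m \<in> seg x y" "m \<in> seg y z" "m \<in> seg x z"
    using median_exists[OF X] .
  have "seg x m \<subseteq> seg x y" "seg m z \<subseteq> seg y z"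
    using seg_subseg X m by blast+
  then show ?thesis
    unfolding seg_split(1)[OF X(1,3) m(3)] by blast
qed

text \<open>
  Two arcs that overlap in a nontrivial arc fit together. This is the local-to-global
  principle of trees: a path without backtracking is an arc.
\<close>

lemma seg_chain:
  assumes X: "x \<in> topspace X" "y \<in> topspace X" "z \<in> topspace X" "w \<in> topspace X"
    and yz: "y \<in> seg x z" "z \<in> seg y w" "y \<noteq> z"
  shows "y \<in> seg x w"
proof -
  have "y \<notin> seg z w"
    using seg_split(2)[OF X(2,4) yz(2)] seg_ends(1)[OF X(2,3)] yz(3) by blast
  then show ?thesis
    using seg_triangle[OF X(1,4,3)] yz(1) seg_sym[OF X(3,4)] by auto
qed

lemma seg_shorten:
  assumes X: "x \<in> topspace X" "w \<in> topspace X"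
    and y: "y \<in> seg x w" and z: "z \<in> seg y w"
  shows "y \<in> seg x z"
proof -
  have yX: "y \<in> topspace X" using seg_in X y by blast
  then have zX: "z \<in> topspace X" using seg_in X z by blast
  have "seg x y \<inter> seg y z \<subseteq> {y}"
    using seg_split(2)[OF X y] seg_subseg(1)[OF yX X(2) z] by blast
  then show ?thesis using seg_concat X(1) yX zX by blast
qed

lemma seg_map:
  assumes f: "continuous_map X X f" "inj_on f (topspace X)"
    and X: "x \<in> topspace X" "y \<in> topspace X"
  shows "seg (f x) (f y) = f ` seg x y"
proof (cases "x = y")
  case False
  obtain h where h: "continuous_map (top_of_set {0..1::real}) X h" "inj_on h {0..1}"
    "h 0 = x" "h 1 = y" "seg x y = h ` {0..1}"
    using seg_param[OF X False] by metis
  have "h ` {0..1} \<subseteq> topspace X"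
    using continuous_map_image_subset_topspace[OF h(1)] by simp
  then have "inj_on (f \<circ> h) {0..1}"
    using h(2) f(2) by (meson comp_inj_on inj_on_subset)
  from seg_image[OF continuous_map_compose[OF h(1) f(1)] this, of 0 1]
  show ?thesis using h(3-5) by (simp add: image_comp closed_segment_eq_real_ivl)
qed auto

text \<open>
  Consider \<open>x\<close>, \<open>f x\<close> and \<open>f (f x)\<close>. The image of the arc from \<open>x\<close> to \<open>f x\<close> may first run back
  along this arc, up to the median \<open>c\<close>. As long as the preimage \<open>z\<close> of \<open>c\<close> comes no later than
  \<open>c\<close> on the arc, the arcs from \<open>z\<close> to \<open>c = f z\<close> and from \<open>c\<close> to \<open>f c\<close> lie on different sides of
  \<open>c\<close>. Otherwise \<open>f\<close> reverses a part of the arc onto another part that overlaps it, and has a fixed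
  point.
\<close>

lemma fixed_point_free_axis:
  assumes f: "continuous_map X X f" "inj_on f (topspace X)"
    and free: "\<And>x. x \<in> topspace X \<Longrightarrow> f x \<noteq> x"
    and ne: "x \<in> topspace X"
  obtains z where "z \<in> topspace X" "f z \<in> seg z (f (f z))"
proof -
  have fX: "f y \<in> topspace X" if "y \<in> topspace X" for y
    using f(1) that by (auto simp: continuous_map_def)
  note X = ne fX[OF ne] fX[OF fX[OF ne]]
  obtain c where c: "c \<in> seg x (f x)" "c \<in> seg (f x) (f (f x))" "c \<in> seg x (f (f x))"
    using median_exists[OF X] .
  obtain h where h: "continuous_map (top_of_set {0..1::real}) X h" "inj_on h {0..1}"
    "h 0 = x" "h 1 = f x" "seg x (f x) = h ` {0..1}"
    using seg_param[OF X(1,2)] free[OF ne] by metis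
  have hX: "h s \<in> topspace X" if "s \<in> {0..1}" for s
    using h(1) that by (auto simp: continuous_map_def)
  obtain s where s: "s \<in> {0..1}" "c = h s" using c(1) h(5) by auto
  obtain t where t: "t \<in> {0..1}" "c = f (h t)"
    using c(2) h(5) seg_map[OF f X(1,2)] by auto
  have fseg: "seg (f (h u)) (f (h v)) = f ` h ` closed_segment u v"
    if "u \<in> {0..1}" "v \<in> {0..1}" for u v
    using seg_map[OF f hX hX] seg_image[OF h(1,2)] that by simp
  show thesis
  proof (cases "t \<le> s")
    case True
    have "seg (h t) c \<subseteq> seg x c"
      using seg_image[OF h(1,2), of t s] seg_image[OF h(1,2), of 0 s] s t True h(3)
      by (auto simp: closed_segment_eq_real_ivl)
    moreover have "seg c (f c) \<subseteq> seg c (f (f x))"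
      using fseg[of t s] fseg[of t 1] s t True h(4)
      by (auto simp: closed_segment_eq_real_ivl)
    moreover have "seg x c \<inter> seg c (f (f x)) = {c}"
      using seg_split(2)[OF X(1,3) c(3)] .
    ultimately have "c \<in> seg (h t) (f c)"
      using hX s t fX by (intro seg_concat) auto
    then show thesis using that[of "h t"] t hX by auto
  next
    case False
    \<comment> \<open>Here \<open>f\<close> turns a part of the arc around inside the arc itself, so the intermediate
      value theorem gives a fixed point.\<close>
    have "homeomorphic_map (top_of_set {0..1}) (subtopology X (h ` {0..1})) h"
      using embedding_interval[OF h(1,2)] .
    then obtain k where k: "homeomorphic_maps (top_of_set {0..1}) (subtopology X (h ` {0..1})) h k"
      by (auto simp: homeomorphic_map_maps)
    have kc: "continuous_map (subtopology X (h ` {0..1})) (top_of_set {0..1}) k"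
      and kh: "\<And>u. u \<in> {0..1} \<Longrightarrow> k (h u) = u"
      using k by (auto simp: homeomorphic_maps_def)
    have "seg (f x) c \<subseteq> seg (f x) x"
      using seg_subseg(1)[OF X(2,1)] c(1) seg_sym[OF X(1,2)] by simp
    then have sub: "f ` h ` {0..t} \<subseteq> h ` {0..1}"
      using fseg[of 0 t] t h(3,5) seg_sym[OF X(1,2)] by (simp add: closed_segment_eq_real_ivl)
    have fh: "continuous_map (top_of_set {0..t}) (subtopology X (h ` {0..1})) (f \<circ> h)"
    proof -
      have "continuous_map (top_of_set {0..t}) X h"
        using continuous_map_from_subtopology_mono[OF h(1), of "{0..t}"] t by auto
      then have "continuous_map (top_of_set {0..t}) X (f \<circ> h)"
        using f(1) by (rule continuous_map_compose)
      then show ?thesis using sub by (auto simp: continuous_map_in_subtopology)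
    qed
    have "continuous_map (top_of_set {0..t}) (top_of_set {0..1}) (k \<circ> (f \<circ> h))"
      using fh kc by (rule continuous_map_compose)
    then have "continuous_on {0..t} (k \<circ> (f \<circ> h))"
      by (simp add: continuous_map_in_subtopology)
    then have cont: "continuous_on {0..t} (\<lambda>u. u - k (f (h u)))"
      unfolding o_def by (intro continuous_on_diff continuous_on_id)
    have "k (f (h 0)) = 1" using kh[of 1] h(3,4) by simp
    moreover have "k (f (h t)) = s" using kh[of s] s t by simp
    ultimately have "\<exists>u\<ge>0. u \<le> t \<and> u - k (f (h u)) = 0"
      using False t by (intro IVT' cont) simp_all
    then obtain u where u: "u \<in> {0..t}" "k (f (h u)) = u" by auto
    then have "f (h u) \<in> h ` {0..1}" using sub by blast
    then obtain v where v: "v \<in> {0..1}" "f (h u) = h v" by blast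
    then have "f (h u) = h u" using kh[of v] u(2) by simp
    then show thesis using free[OF hX[of u]] u(1) t(1) by simp
  qed
qed

text \<open>
  To see that the map is open, take an interval around \<open>t\<close>. A small arcwise connected open
  neighbourhood of \<open>f t\<close> avoids the images of the two ends of the interval. Its points are joined
  to \<open>f t\<close> by arcs inside it, which are images of intervals; these cannot cross the two ends.
\<close>

lemma homeomorphic_real_if_bijective_line:
  assumes f: "continuous_map euclideanreal X f" "inj f" "range f = topspace X"
  shows "X homeomorphic_space euclideanreal"
proof -
  have seg: "seg (f s) (f t) = f ` closed_segment s t" for s t
  proof (rule seg_image)
    show "continuous_map (top_of_set {min s t..max s t}) X f"
      using f(1) by (rule continuous_map_from_subtopology)
    show "inj_on f {min s t..max s t}" using f(2) by (rule inj_on_subset) simp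
  qed auto
  have "open_map euclideanreal X f"
    unfolding open_map_def
  proof (intro allI impI)
    fix U :: "real set" assume "openin euclideanreal U"
    then have U: "open U" by simp
    show "openin X (f ` U)"
    proof (subst openin_subopen, rule ballI)
      fix y assume "y \<in> f ` U"
      then obtain t where t: "t \<in> U" "y = f t" by auto
      obtain d where d: "d > 0" "{t-d<..<t+d} \<subseteq> U"
        using openE[OF U t(1)] unfolding ball_eq_greaterThanLessThan by blast
      let ?W = "topspace X - {f (t-d), f (t+d)}"
      have "openin X ?W"
        using f(3) by (intro openin_diff closedin_Hausdorff_finite[OF hausdorff] openin_topspace) blast+
      moreover have "y \<in> ?W"
        using rangeI[of f t] d(1) unfolding f(3) t(2) by (simp add: inj_eq[OF f(2)])
      ultimately obtain V where V: "openin X V" "y \<in> V" "V \<subseteq> ?W"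
        "arcwise_connected_space (subtopology X V)"
        using arcwise_connected_nbhd[of ?W y] by blast
      have VX: "V \<subseteq> topspace X" using V(1) openin_subset by blast
      have "V \<subseteq> f ` U"
      proof
        fix v assume v: "v \<in> V"
        show "v \<in> f ` U"
        proof (cases "v = y")
          case False
          then obtain A where A: "arc_with_ends (subtopology X V) y v A"
            using V(2,4) v VX unfolding arcwise_connected_space_def
            by (simp add: Int_absorb1) metis
          then have AV: "A \<subseteq> V" and "arc_with_ends X y v A"
            by (auto simp: arc_with_ends_def subtopology_subtopology Int_absorb1)
          then have "seg y v = A" using seg_eqI False by metis
          moreover obtain u where u: "v = f u" using v VX f(3) by blast
          ultimately have "f ` closed_segment t u \<subseteq> V" using AV seg t(2) by auto
          then have "t - d \<notin> closed_segment t u" "t + d \<notin> closed_segment t u"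
            using V(3) by auto
          then have "u \<in> {t-d<..<t+d}"
            using d(1) by (auto simp: closed_segment_eq_real_ivl split: if_splits)
          then show ?thesis using d(2) u by auto
        qed (use t in auto)
      qed
      then show "\<exists>T. openin X T \<and> y \<in> T \<and> T \<subseteq> f ` U" using V by blast
    qed
  qed
  then have "homeomorphic_map euclideanreal X f"
    using f by (intro bijective_open_imp_homeomorphic_map) auto
  then show ?thesis
    using homeomorphic_map_imp_homeomorphic_space homeomorphic_space_sym by blast
qed

end

section \<open>Translations of a tree that is a group\<close>

locale tree_group = tree_space X + group G
  for X :: "'a topology" and G :: "('a, 'b) monoid_scheme" (structure) +
  assumes topspace_eq: "topspace X = carrier G"
    and left_continuous: "g \<in> carrier G \<Longrightarrow> continuous_map X X (\<lambda>x. g \<otimes> x)"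
    and right_continuous: "g \<in> carrier G \<Longrightarrow> continuous_map X X (\<lambda>x. x \<otimes> g)"
begin

lemmas seg_closed = seg_in[unfolded topspace_eq]
  and ends = seg_ends[unfolded topspace_eq]
  and commute = seg_sym[unfolded topspace_eq]
  and chain = seg_chain[unfolded topspace_eq]
  and split = seg_split[unfolded topspace_eq]
  and subseg = seg_subseg[unfolded topspace_eq]
  and shorten = seg_shorten[unfolded topspace_eq]
  and triangle = seg_triangle[unfolded topspace_eq]

lemma seg_left_mult:
  assumes "g \<in> carrier G" "x \<in> carrier G" "y \<in> carrier G"
  shows "seg (g \<otimes> x) (g \<otimes> y) = (\<lambda>z. g \<otimes> z) ` seg x y"
  using assms seg_map[OF left_continuous] inj_on_cmult by (simp add: topspace_eq)

lemma left_mult_in_seg: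
  assumes "g \<in> carrier G" "x \<in> carrier G" "y \<in> carrier G" "z \<in> carrier G"
  shows "g \<otimes> y \<in> seg (g \<otimes> x) (g \<otimes> z) \<longleftrightarrow> y \<in> seg x z"
proof -
  have "seg x z \<subseteq> carrier G" using assms seg_closed by blast
  then show ?thesis
    using seg_left_mult[of g x z] inj_on_image_mem_iff[OF inj_on_cmult] assms by simp
qed

text \<open>
  Only one point of the axis is known from the fixed-point argument; left translations, which
  commute with the right translation by \<open>a\<close>, carry it to all other points.
\<close>

lemma right_axis:
  assumes a: "a \<in> carrier G" and x: "x \<in> carrier G"
  shows "x \<otimes> a \<in> seg x (x \<otimes> a \<otimes> a)"
proof (cases "a = \<one>")
  case False
  have "inj_on (\<lambda>x. x \<otimes> a) (topspace X)"
    using inj_on_multc a by (simp add: topspace_eq)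
  moreover have "y \<otimes> a \<noteq> y" if "y \<in> topspace X" for y
    using that a False by (simp add: topspace_eq)
  ultimately obtain z where z: "z \<in> carrier G" "z \<otimes> a \<in> seg z (z \<otimes> a \<otimes> a)"
    using fixed_point_free_axis[OF right_continuous[OF a], of \<one>] unfolding topspace_eq by auto
  then have "a \<in> seg \<one> (a \<otimes> a)"
    using left_mult_in_seg[of z \<one> a "a \<otimes> a"] a by (simp add: m_assoc)
  then show ?thesis
    using left_mult_in_seg[of x \<one> a "a \<otimes> a"] a x by (simp add: m_assoc)
qed (use x in simp)

lemma left_axis:
  assumes a: "a \<in> carrier G" and x: "x \<in> carrier G"
  shows "a \<otimes> x \<in> seg x (a \<otimes> (a \<otimes> x))"
proof -
  have "x \<otimes> (inv x \<otimes> (a \<otimes> x)) = a \<otimes> x"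
    using a x by (simp add: m_assoc[symmetric])
  moreover have "x \<otimes> (inv x \<otimes> (a \<otimes> x)) \<otimes> (inv x \<otimes> (a \<otimes> x)) = a \<otimes> (a \<otimes> x)"
    using a x by (simp add: m_assoc[symmetric]) (simp add: m_assoc)
  ultimately show ?thesis
    using right_axis[of "inv x \<otimes> (a \<otimes> x)" x] a x by simp
qed

text \<open>
  Otherwise the arc to \<open>b\<close> leaves the axis of the left translation by \<open>a\<close> at \<open>\<one>\<close>, and its translate
  leaves it at \<open>a\<close>. Then both \<open>seg b (a \<otimes> b)\<close> and \<open>seg (a \<otimes> b) (a \<otimes> (a \<otimes> b))\<close> pass through \<open>a\<close>, although by
  \<open>left_axis\<close> they meet only in \<open>a \<otimes> b\<close>.
\<close>

lemma two_directions:
  assumes a: "a \<in> carrier G" "a \<noteq> \<one>" and b: "b \<in> carrier G"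
    and ba: "\<one> \<in> seg b a" and bia: "\<one> \<in> seg b (inv a)"
  shows "b = \<one>"
proof -
  have ab: "a \<otimes> b \<in> carrier G" "a \<otimes> (a \<otimes> b) \<in> carrier G" "a \<otimes> a \<in> carrier G" "\<one> \<in> carrier G"
    using a b by auto
  have 1: "a \<in> seg (a \<otimes> b) \<one>"
    using left_mult_in_seg[of a b \<one> "inv a"] a b bia by simp
  have "a \<in> seg (a \<otimes> b) b"
    using chain[OF ab(1) a(1) ab(4) b 1] ba commute[OF b a(1)] a(2) by simp
  then have A: "a \<in> seg b (a \<otimes> b)" using commute[OF ab(1) b] by simp
  have 2: "a \<in> seg (a \<otimes> b) (a \<otimes> a)"
    using left_mult_in_seg[of a b \<one> a] a b ba by simp
  have "a \<otimes> a \<in> seg (a \<otimes> (a \<otimes> b)) a"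
    using left_mult_in_seg[of a "a \<otimes> b" a \<one>] a ab 1 by simp
  then have "a \<otimes> a \<in> seg a (a \<otimes> (a \<otimes> b))" using commute[OF ab(2) a(1)] by simp
  then have B: "a \<in> seg (a \<otimes> b) (a \<otimes> (a \<otimes> b))"
    using chain[OF ab(1) a(1) ab(3) ab(2) 2] a by simp
  have "a = a \<otimes> b"
    using split(2)[OF b ab(2) left_axis[OF a(1) b]] A B by blast
  then show ?thesis using a b by simp
qed

text \<open>
  If the median of three points is none of them, it can be moved to \<open>\<one>\<close>. The three points then
  lie in three different directions from \<open>\<one>\<close>, whereas the direction of the first and of its
  inverse are the only ones.
\<close>

lemma no_branching:
  assumes X: "x \<in> carrier G" "y \<in> carrier G" "z \<in> carrier G"
  shows "x \<in> seg y z \<or> y \<in> seg x z \<or> z \<in> seg x y"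
proof (rule ccontr)
  assume neg: "\<not> ?thesis"
  obtain m where m: "m \<in> seg x y" "m \<in> seg y z" "m \<in> seg x z"
    using median_exists[unfolded topspace_eq, OF X] .
  have mX: "m \<in> carrier G" using seg_closed m X by blast
  define p q r where pqr: "p = inv m \<otimes> x" "q = inv m \<otimes> y" "r = inv m \<otimes> z"
  have C: "p \<in> carrier G" "q \<in> carrier G" "r \<in> carrier G" "inv p \<in> carrier G"
    using X mX by (auto simp: pqr)
  have "m \<otimes> p = x" "m \<otimes> q = y" "m \<otimes> r = z"
    using X mX by (auto simp: pqr m_assoc[symmetric])
  then have S: "\<one> \<in> seg p q" "\<one> \<in> seg q r" "\<one> \<in> seg p r"
    using left_mult_in_seg[of m _ \<one>] C mX m by auto
  have "p \<noteq> \<one>" "q \<noteq> \<one>" "r \<noteq> \<one>"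
    using neg m \<open>m \<otimes> p = x\<close> \<open>m \<otimes> q = y\<close> \<open>m \<otimes> r = z\<close> mX by auto
  then have "\<one> \<notin> seg q (inv p)" "\<one> \<notin> seg r (inv p)"
    using two_directions C S commute by metis+
  then show False
    using triangle[OF C(2,4,3)] S(2) commute[OF C(3,4)] by auto
qed

section \<open>The powers of an element\<close>

lemma pow_step:
  assumes a: "a \<in> carrier G"
  shows "a [^] (n::nat) \<in> seg \<one> (a [^] Suc n)"
proof (cases "a = \<one>")
  case False
  show ?thesis
  proof (induction n)
    case 0
    show ?case using ends a by simp
  next
    case (Suc n)
    have C: "a [^] n \<in> carrier G" "a [^] Suc n \<in> carrier G" "a [^] Suc (Suc n) \<in> carrier G"
      using a by (auto simp del: nat_pow_Suc)
    have "a [^] Suc n \<in> seg (a [^] n) (a [^] Suc (Suc n))"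
      using right_axis[OF a C(1)] by simp
    moreover have "a [^] Suc n \<noteq> a [^] n" using a False C(1) by simp
    ultimately have "a [^] Suc n \<in> seg (a [^] Suc (Suc n)) \<one>"
      using chain[OF C(3,2,1) one_closed] Suc.IH commute C one_closed by metis
    then show ?case using commute C one_closed by metis
  qed
qed simp

lemma pow_mono:
  assumes a: "a \<in> carrier G" and "m \<le> n"
  shows "a [^] (m::nat) \<in> seg \<one> (a [^] n)"
  using \<open>m \<le> n\<close>
proof (induction n rule: dec_induct)
  case base
  show ?case using ends a by simp
next
  case (step n)
  have "seg \<one> (a [^] n) \<subseteq> seg \<one> (a [^] Suc n)"
    using a by (intro subseg(1) pow_step) auto
  then show ?case using step.IH by blast
qed

lemma int_pow_between:
  fixes i j k :: int
  assumes a: "a \<in> carrier G" and "i \<le> j" "j \<le> k"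
  shows "a [^] j \<in> seg (a [^] i) (a [^] k)"
proof -
  have "a [^] (j - i) \<in> seg \<one> (a [^] (k - i))"
    using pow_mono[OF a, of "nat (j - i)" "nat (k - i)"] assms
    by (simp flip: int_pow_int)
  then have "a [^] i \<otimes> a [^] (j - i) \<in> seg (a [^] i \<otimes> \<one>) (a [^] i \<otimes> a [^] (k - i))"
    using a by (subst left_mult_in_seg) auto
  then show ?thesis using a by (simp flip: int_pow_mult)
qed

text \<open>
  Powers of \<open>a\<close> inside one arc form a monotone sequence there, hence converge. Continuity of
  the right translation by \<open>a\<close> makes the limit a fixed point of it, which forces \<open>a = \<one>\<close>.
\<close>

lemma powers_leave_arc:
  assumes a: "a \<in> carrier G" "a \<noteq> \<one>" and y: "y \<in> carrier G"
  shows "\<exists>n::nat. a [^] n \<notin> seg \<one> y"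
proof (rule ccontr)
  assume "\<not> ?thesis"
  then have all: "a [^] n \<in> seg \<one> y" for n :: nat by blast
  then have "y \<noteq> \<one>" using all[of 1] a by auto
  then obtain h where h: "continuous_map (top_of_set {0..1::real}) X h" "inj_on h {0..1}"
    "h 0 = \<one>" "h 1 = y" "seg \<one> y = h ` {0..1}"
    using seg_param[unfolded topspace_eq, OF one_closed y] by metis
  have "\<forall>n. \<exists>t. t \<in> {0..1} \<and> a [^] (n::nat) = h t" using all h(5) by blast
  then obtain t where t: "\<And>n. t n \<in> {0..1}" "\<And>n::nat. a [^] n = h (t n)" by metis
  have "incseq t"
  proof (rule incseq_SucI)
    fix n
    have "seg (h 0) (h (t (Suc n))) = h ` {0..t (Suc n)}"
      using seg_image[OF h(1,2), of 0 "t (Suc n)"] t(1)[of "Suc n"]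
      by (simp add: closed_segment_eq_real_ivl)
    then obtain u where u: "u \<in> {0..t (Suc n)}" "h (t n) = h u"
      using pow_step[OF a(1), of n] t(2)[of n] t(2)[of "Suc n"] h(3) by auto
    have "u \<in> {0..1}" using u(1) t(1)[of "Suc n"] by auto
    then have "t n = u" using inj_onD[OF h(2) u(2) t(1)] by simp
    then show "t n \<le> t (Suc n)" using u(1) by simp
  qed
  moreover have "\<forall>n. t n \<le> 1" using t(1) by auto
  ultimately obtain L where L: "t \<longlonglongrightarrow> L"
    using incseq_convergent by blast
  have "L \<in> {0..1}"
    using closed_sequentially[OF closed_atLeastAtMost _ L] t(1) by blast
  then have "limitin (top_of_set {0..1}) t L sequentially"
    using L t(1) by (simp add: limitin_subtopology)
  from continuous_map_limit[OF h(1) this]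
  have lim: "limitin X (\<lambda>n. a [^] n) (h L) sequentially"
    using t(2) by (simp add: o_def)
  have "limitin X (\<lambda>n. a [^] Suc n) (h L \<otimes> a) sequentially"
    using continuous_map_limit[OF right_continuous[OF a(1)] lim] by (simp add: o_def)
  moreover have "limitin X (\<lambda>n. a [^] Suc n) (h L) sequentially"
    using limitin_sequentially_offset[OF lim, of 1] by simp
  ultimately have "h L \<otimes> a = h L"
    using limitin_Hausdorff_unique[OF _ _ _ hausdorff] trivial_limit_sequentially by blast
  moreover have "h L \<in> carrier G" using limitin_topspace[OF lim] topspace_eq by simp
  ultimately show False using a by simp
qed

text \<open>
  A point outside all these arcs lies, for every \<open>n\<close>, beyond the power \<open>n\<close> or beyond the power
  \<open>-n\<close> as seen from \<open>\<one>\<close>, for lack of branching. Choosing \<open>n\<close> so large that neither power stays in the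
  arc from \<open>\<one>\<close> to the point gives a contradiction.
\<close>

lemma powers_cofinal:
  assumes a: "a \<in> carrier G" "a \<noteq> \<one>" and y: "y \<in> carrier G"
  shows "\<exists>n::nat. y \<in> seg (inv a [^] n) (a [^] n)"
proof (rule ccontr)
  assume neg: "\<not> ?thesis"
  have half: "b \<in> seg \<one> y"
    if "b \<in> carrier G" "c \<in> carrier G" "\<one> \<in> seg b c" "b \<in> seg y c" for b c
    using shorten[OF y that(2,4,3)] commute[OF y one_closed] by simp
  have C: "a [^] n \<in> carrier G" "inv a [^] n \<in> carrier G" for n :: nat
    using a by auto
  have beyond: "a [^] n \<in> seg \<one> y \<or> inv a [^] n \<in> seg \<one> y" for n :: nat
  proof -
    have one: "\<one> \<in> seg (a [^] n) (inv a [^] n)"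
    proof -
      have "a [^] (0::int) \<in> seg (a [^] (- int n)) (a [^] (int n))"
        by (rule int_pow_between[OF a(1)]) auto
      then show ?thesis
        using a commute[OF C] by (simp add: int_pow_neg int_pow_int nat_pow_inv)
    qed
    have "a [^] n \<in> seg y (inv a [^] n) \<or> inv a [^] n \<in> seg y (a [^] n)"
      using no_branching[OF y C] neg commute C y by metis
    then show ?thesis
      using half[OF C one] half[OF C(2,1)] one commute[OF C] by auto
  qed
  have down: "b [^] m \<in> seg \<one> y" if "b [^] n \<in> seg \<one> y" "m \<le> n" "b \<in> carrier G" for b m and n :: nat
    using subseg(1)[OF one_closed y that(1)] pow_mono[OF that(3,2)] by blast
  obtain n where n: "a [^] (n::nat) \<notin> seg \<one> y" using powers_leave_arc a y by blast
  have "inv a \<noteq> \<one>" using a by simp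
  then obtain m where m: "inv a [^] (m::nat) \<notin> seg \<one> y"
    using powers_leave_arc[of "inv a" y] a y by blast
  show False
    using beyond[of "max m n"] down[of a "max m n" n] down[of "inv a" "max m n" m] m n a by auto
qed

text \<open>
  The line is \<open>F\<close>, which on the interval from \<open>i\<close> to \<open>i + 1\<close> traverses the translate by
  \<open>a [^] i\<close> of the arc from \<open>\<one>\<close> to \<open>a\<close>. It is injective since the integer powers of \<open>a\<close> occur in
  order along arcs, and surjective by \<open>powers_cofinal\<close>.
\<close>

lemma homeomorphic_real:
  assumes a: "a \<in> carrier G" "a \<noteq> \<one>"
  shows "X homeomorphic_space euclideanreal"
proof -
  obtain h where h: "continuous_map (top_of_set {0..1::real}) X h" "inj_on h {0..1}"
    "h 0 = \<one>" "h 1 = a" "seg \<one> a = h ` {0..1}"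
    using seg_param[unfolded topspace_eq, OF one_closed a(1)] a(2) by metis
  have hC: "h u \<in> carrier G" if "u \<in> {0..1}" for u
    using h(5) that seg_closed[OF one_closed a(1)] by blast
  have P: "a [^] i \<in> carrier G" for i :: int using a by simp
  define F where "F = (\<lambda>t. a [^] \<lfloor>t\<rfloor> \<otimes> h (t - of_int \<lfloor>t\<rfloor>))"
  have F_int: "F (of_int i) = a [^] i" for i using P h(3) by (simp add: F_def)
  have fr: "t - of_int \<lfloor>t\<rfloor> \<in> {0..1}" for t :: real
    by (simp add: le_diff_eq) linarith
  have F_seg: "F t \<in> seg (a [^] \<lfloor>t\<rfloor>) (a [^] (\<lfloor>t\<rfloor> + 1))" for t
  proof -
    have "a [^] (\<lfloor>t\<rfloor> + 1) = a [^] \<lfloor>t\<rfloor> \<otimes> a" using a by (simp add: int_pow_mult)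
    moreover have "h (t - of_int \<lfloor>t\<rfloor>) \<in> seg \<one> a" using h(5) fr by blast
    ultimately show ?thesis
      using left_mult_in_seg[OF P one_closed hC[OF fr] a(1)] P unfolding F_def by simp
  qed
  have cont: "continuous_map euclideanreal X F"
  proof (rule pasting_lemma_locally_finite)
    fix i :: int
    have "continuous_map (top_of_set {of_int i..of_int i + 1}) (top_of_set {0..1}) (\<lambda>t::real. t - of_int i)"
      by (auto simp: continuous_map_in_subtopology intro!: continuous_intros)
    from continuous_map_compose[OF continuous_map_compose[OF this h(1)] left_continuous[OF P[of i]]]
    show "continuous_map (top_of_set {of_int i..of_int i + 1}) X (\<lambda>t. a [^] i \<otimes> h (t - of_int i))"
      by (simp add: o_def)
  next
    fix x :: real
    \<comment> \<open>The margin 3 is generous; only finiteness matters.\<close>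
    have "{i \<in> UNIV. {of_int i..of_int i + 1} \<inter> {x - 1<..<x + 1} \<noteq> {}} \<subseteq> {\<lfloor>x\<rfloor> - 3..\<lfloor>x\<rfloor> + 3}"
      by auto linarith+
    then have "finite {i \<in> UNIV. {of_int i..of_int i + 1} \<inter> {x - 1<..<x + 1} \<noteq> {}}"
      using finite_subset by blast
    then show "\<exists>V. openin euclideanreal V \<and> x \<in> V \<and>
        finite {i \<in> UNIV. {of_int i..of_int i + 1} \<inter> V \<noteq> {}}"
      by (intro exI[of _ "{x - 1<..<x + 1}"]) auto
  next
    fix i j :: int and x :: real
    assume x: "x \<in> topspace euclideanreal \<inter> {of_int i..of_int i + 1} \<inter> {of_int j..of_int j + 1}"
    \<comment> \<open>Two different pieces meet only at an integer, where both equal a power of \<open>a\<close>.\<close>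
    have step: "a [^] k \<otimes> h (of_int (k + 1) - of_int k) = a [^] (k + 1) \<otimes> h (of_int (k + 1) - of_int (k + 1))"
      for k :: int
      using a h(3,4) by (simp add: int_pow_mult)
    consider "i = j" | "j = i + 1" "x = of_int (i + 1)" | "i = j + 1" "x = of_int (j + 1)"
      using x by (simp, linarith)
    then show "a [^] i \<otimes> h (x - of_int i) = a [^] j \<otimes> h (x - of_int j)"
      by cases (use step in simp_all)
  next
    fix x :: real
    show "\<exists>j. j \<in> UNIV \<and> x \<in> {of_int j..of_int j + 1} \<and> F x = a [^] j \<otimes> h (x - of_int j)"
      using fr[of x] by (intro exI[of _ "\<lfloor>x\<rfloor>"]) (auto simp: F_def)
  qed auto
  have less: "F s \<noteq> F t" if "s < t" for s t
  proof
    assume eq: "F s = F t"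
    have frac_s: "h (s - of_int \<lfloor>s\<rfloor>) = h u \<longrightarrow> s - of_int \<lfloor>s\<rfloor> = u" if "u \<in> {0..1}" for u
      using inj_onD[OF h(2) _ fr that] by blast
    show False
    proof (cases "\<lfloor>s\<rfloor> = \<lfloor>t\<rfloor>")
      case True
      then have "h (s - of_int \<lfloor>s\<rfloor>) = h (t - of_int \<lfloor>t\<rfloor>)"
        using eq P[of "\<lfloor>t\<rfloor>"] hC[OF fr[of s]] hC[OF fr[of t]] True by (simp add: F_def)
      then show False using frac_s[OF fr[of t]] True \<open>s < t\<close> by simp
    next
      case False
      let ?m = "\<lfloor>s\<rfloor>" and ?k = "\<lfloor>t\<rfloor>"
      have mk: "?m + 1 \<le> ?k" using False floor_mono[of s t] \<open>s < t\<close> by linarith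
      have "seg (a [^] ?k) (a [^] (?k + 1)) \<subseteq> seg (a [^] (?m + 1)) (a [^] (?k + 1))"
        using mk by (intro subseg(2) int_pow_between[OF a(1)] P) auto
      then have "F s \<in> seg (a [^] (?m + 1)) (a [^] (?k + 1))"
        using eq F_seg[of t] by auto
      moreover have "a [^] (?m + 1) \<in> seg (a [^] ?m) (a [^] (?k + 1))"
        using mk by (intro int_pow_between[OF a(1)]) auto
      ultimately have "F s = a [^] (?m + 1)"
        using split(2)[OF P P] F_seg[of s] by blast
      then have "a [^] ?m \<otimes> h (s - of_int ?m) = a [^] ?m \<otimes> h 1"
        using a h(4) by (simp add: F_def int_pow_mult)
      then have "h (s - of_int ?m) = h 1" using P hC[OF fr] hC[of 1] by simp
      then have "s - of_int ?m = 1" using frac_s[of 1] by simp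
      then show False by linarith
    qed
  qed
  have inj: "inj F" by (rule linorder_injI) (rule less)
  have "y \<in> range F" if y: "y \<in> carrier G" for y
  proof -
    obtain n where n: "y \<in> seg (inv a [^] n) (a [^] (n::nat))"
      using powers_cofinal[OF a y] by blast
    have "continuous_map (top_of_set {- real n..real n}) X F" "inj_on F {- real n..real n}"
      using continuous_map_from_subtopology[OF cont] inj_on_subset[OF inj] by simp_all
    then have "seg (F (- real n)) (F (real n)) = F ` closed_segment (- real n) (real n)"
      by (rule seg_image) auto
    moreover have "F (- real n) = inv a [^] n" "F (real n) = a [^] n"
      using F_int[of "- int n"] F_int[of "int n"] a
      by (simp_all add: int_pow_neg int_pow_int nat_pow_inv)
    ultimately show ?thesis using n by auto
  qed
  then have "range F = topspace X"
    using continuous_map_image_subset_topspace[OF cont] topspace_eq by auto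
  with cont inj show ?thesis by (rule homeomorphic_real_if_bijective_line)
qed

end

theorem theorem5p2:
  fixes X :: "'a topology" and G :: "('a, 'b) monoid_scheme"
  assumes "topological_tree X"
    and "group G" and "carrier G = topspace X"
    and "\<And>g. g \<in> carrier G \<Longrightarrow> continuous_map X X (\<lambda>x. g \<otimes>\<^bsub>G\<^esub> x)"
    and "\<And>g. g \<in> carrier G \<Longrightarrow> continuous_map X X (\<lambda>x. x \<otimes>\<^bsub>G\<^esub> g)"
    and "\<exists>x\<in>topspace X. \<exists>y\<in>topspace X. x \<noteq> y"
  shows "X homeomorphic_space euclideanreal"
proof -
  interpret group G by fact
  interpret tree_group X G
    using assms(1,3-5) by unfold_locales auto
  obtain a where "a \<in> carrier G" "a \<noteq> \<one>\<^bsub>G\<^esub>"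
    using assms(3,6) by metis
  then show ?thesis by (rule homeomorphic_real)
qed
end
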